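(* For any plane tree $T$ (with $n\ge 1$ edges) and any node $v$ of $T$, $$(\mathsf{lev},\mathsf{lsw},\mathsf{rsw})_{T}(v)=(\mathsf{dlev},\mathsf{dlsw},\mathsf{drsw})_{\tilde\phi(T)}(v).$$
   Context: **Plane trees.** A plane tree is a rooted tree in which the children of each node are linearly ordered (left to right). $\mathcal{P}_n$ is the set of plane trees with $n\ge1$ edges. The nodes of $T\in\mathcal P_n$ are named $0,1,\dots,n$ (only to distinguish them), the root being $0$ and the leftmost child of the root being $1$. Nodes with the same parent are siblings; siblings to the left of a node are elder, those to the right are younger; the eldest child of a node is its leftmost child. **Binary trees and the involution $\tilde\phi$.** A binary tree is a rooted tree in which each node has at most one left child and at most one right child; $\mathcal{B}_n$ is the set of binary trees with $n$ nodes. The bijection $\varphi:\mathcal P_n\to\mathcal B_n$: the nodes of $\varphi(T)$ are the non-root nodes of $T$; its root is the leftmost child of the root of $T$; for non-root nodes $x,y$ of $T$, $y$ is the left child of $x$ in $\varphi(T)$ iff $y$ is the leftmost child of $x$ in $T$, and $y$ is the right child of $x$ in $\varphi(T)$ iff $x$ is the closest elder sibling of $y$ in $T$. For $B\in\mathcal B_n$, $\phi(B)$ is the mirror image of $B$ (same nodes, left and right children exchanged). Put $\tilde\phi=\varphi^{-1}\circ\phi\circ\varphi:\mathcal P_n\to\mathcal P_n$. Node names are kept, so $T$ and $\tilde\phi(T)$ have the same node set, both with root $0$. **Statistics of a node $v$ of a plane tree $T$.** - $\mathsf{lev}_T(v)$: number of edges on the path from $v$ to the root. - $\mathsf{Lc}_T(v)$: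 the set of nodes attached to nodes other than $v$ on the path from $v$ to the root from the left-hand side, i.e. the set of all elder siblings of the non-root nodes on this path ($v$ included); $\mathsf{lc}_T(v)=|\mathsf{Lc}_T(v)|$. - $\mathsf{lsw}_T(v)$: the number of children of $v$ plus $\mathsf{lc}_T(v)$. - $\mathsf{rsw}_T(v)$: the number of children of $v$ plus the number of edges attached to nodes other than $v$ on the path from $v$ to the root from the right-hand side (i.e. plus the total number of younger siblings of the non-root nodes on this path, $v$ included). - $\mathsf{lchain}_T(v)$: the length (number of edges) of the left chain of $v$, i.e. the path $v=v_1,v_2,\dots,v_k$ where $v_{i+1}$ is the eldest child of $v_i$ and $v_k$ is a leaf. - $\mathsf{dlev}_T(v)=0$ if $v$ is the root, and $\mathsf{dlev}_T(v)=\mathsf{lc}_T(v)+1$ otherwise. - $\mathsf{dlsw}_T(v)=\mathsf{lchain}_T(v)$ if $v$ is the root; $\mathsf{dlsw}_T(v)=\mathsf{lchain}_T(u)+\mathsf{lev}_T(v)$ if $v$ has a closest younger sibling $u$; and $\mathsf{dlsw}_T(v)=\mathsf{lev}_T(v)-1$ otherwise. - $\mathsf{drsw}_T(v)=1+\sum_{w\in\mathsf{Lc}_T(v)\cup\{u,v\}}\mathsf{lchain}_T(w)$ if $v$ has a closest younger sibling $u$; and $\mathsf{drsw}_T(v)=\sum_{w\in\mathsf{Lc}_T(v)\cup\{v\}}\mathsf{lchain}_T(w)$ otherwise. The displayed equality means equality of the three components in order. *)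

theory Defs
  imports "HOL-Library.Tree"
begin

section \<open>Plane trees with named nodes\<close>

datatype 'a ptree = PNode (pname: 'a) (subs: "'a ptree list")

primrec names :: "'a ptree \<Rightarrow> 'a list" where
  "names (PNode x ts) = x # concat (map names ts)"

abbreviation nodes :: "'a ptree \<Rightarrow> 'a set" where
  "nodes T \<equiv> set (names T)"

text \<open>The list of children of the node named \<open>v\<close>, from left to right. If the names in the tree
  are pairwise distinct, at most one of the concatenated lists is nonempty.\<close>

primrec children :: "'a ptree \<Rightarrow> 'a \<Rightarrow> 'a list" where
  "children (PNode x ts) =
     (\<lambda>v. if v = x then map pname ts else concat (map (\<lambda>f. f v) (map children ts)))"

definition eldest_child :: "'a ptree \<Rightarrow> 'a \<Rightarrow> 'a \<Rightarrow> bool" where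
  "eldest_child T x y \<longleftrightarrow> (\<exists>ys. children T x = y # ys)"

definition elder_siblings :: "'a ptree \<Rightarrow> 'a \<Rightarrow> 'a set" where
  "elder_siblings T v = {u. \<exists>p xs ys zs. children T p = xs @ u # ys @ v # zs}"

definition younger_siblings :: "'a ptree \<Rightarrow> 'a \<Rightarrow> 'a set" where
  "younger_siblings T v = {u. \<exists>p xs ys zs. children T p = xs @ v # ys @ u # zs}"

text \<open>\<open>closest_younger T x y\<close>: \<open>y\<close> is the closest younger sibling of \<open>x\<close>; equivalently, \<open>x\<close> is the
  closest elder sibling of \<open>y\<close>.\<close>

definition closest_younger :: "'a ptree \<Rightarrow> 'a \<Rightarrow> 'a \<Rightarrow> bool" where
  "closest_younger T x y \<longleftrightarrow> (\<exists>p xs zs. children T p = xs @ x # y # zs)"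

text \<open>The set \<open>P\<^sub>n\<close> for \<open>n \<ge> 1\<close>. A tree with \<open>n\<close> edges has \<open>n + 1\<close> nodes, named \<open>0, \<dots>, n\<close>.\<close>

definition plane_trees :: "nat \<Rightarrow> nat ptree set" where
  "plane_trees n =
     {T. distinct (names T) \<and> nodes T = {0..n} \<and> pname T = 0 \<and> eldest_child T 0 1}"

section \<open>Binary trees and the involution\<close>

text \<open>The set \<open>B\<^sub>n\<close> for \<open>n \<ge> 1\<close>, with the node names that occur in the images of plane trees.\<close>

definition binary_trees :: "nat \<Rightarrow> nat tree set" where
  "binary_trees n =
     {B. distinct (inorder B) \<and> set_tree B = {1..n} \<and> (\<exists>l r. B = Node l 1 r)}"

definition left_child :: "'a tree \<Rightarrow> 'a \<Rightarrow> 'a \<Rightarrow> bool" where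
  "left_child B x y \<longleftrightarrow> (\<exists>l r t. Node (Node l y r) x t \<in> subtrees B)"

definition right_child :: "'a tree \<Rightarrow> 'a \<Rightarrow> 'a \<Rightarrow> bool" where
  "right_child B x y \<longleftrightarrow> (\<exists>l r t. Node t x (Node l y r) \<in> subtrees B)"

fun varphi_forest :: "'a ptree list \<Rightarrow> 'a tree" where
  "varphi_forest [] = Leaf"
| "varphi_forest (PNode x ts # us) = Node (varphi_forest ts) x (varphi_forest us)"

text \<open>The defining properties of the bijection (nodes, root, left and right children) are the
  lemmas \<open>set_tree_varphi\<close>, \<open>root_varphi\<close>, \<open>left_child_varphi\<close>, \<open>right_child_varphi\<close> below.\<close>

definition varphi :: "'a ptree \<Rightarrow> 'a tree" where
  "varphi T = varphi_forest (subs T)"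

definition phi_tilde :: "nat \<Rightarrow> nat ptree \<Rightarrow> nat ptree" where
  "phi_tilde n T = the_inv_into (plane_trees n) varphi (mirror (varphi T))"

section \<open>Statistics\<close>

text \<open>The nodes on the path from \<open>v\<close> (included) to the root, in this order.\<close>

definition root_path :: "'a ptree \<Rightarrow> 'a \<Rightarrow> 'a list" where
  "root_path T v = (THE p. p \<noteq> [] \<and> hd p = v \<and> last p = pname T \<and>
     successively (\<lambda>x y. x \<in> set (children T y)) p)"

definition lev :: "'a ptree \<Rightarrow> 'a \<Rightarrow> nat" where
  "lev T v = length (root_path T v) - 1"

definition Lc :: "'a ptree \<Rightarrow> 'a \<Rightarrow> 'a set" where
  "Lc T v = (\<Union>w \<in> set (root_path T v) - {pname T}. elder_siblings T w)"

definition lc :: "'a ptree \<Rightarrow> 'a \<Rightarrow> nat" where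
  "lc T v = card (Lc T v)"

definition lsw :: "'a ptree \<Rightarrow> 'a \<Rightarrow> nat" where
  "lsw T v = length (children T v) + lc T v"

definition rsw :: "'a ptree \<Rightarrow> 'a \<Rightarrow> nat" where
  "rsw T v = length (children T v) +
     (\<Sum>w \<in> set (root_path T v) - {pname T}. card (younger_siblings T w))"

definition left_chain :: "'a ptree \<Rightarrow> 'a \<Rightarrow> 'a list" where
  "left_chain T v = (THE c. c \<noteq> [] \<and> hd c = v \<and> children T (last c) = [] \<and>
     successively (eldest_child T) c)"

definition lchain :: "'a ptree \<Rightarrow> 'a \<Rightarrow> nat" where
  "lchain T v = length (left_chain T v) - 1"

definition dlev :: "'a ptree \<Rightarrow> 'a \<Rightarrow> nat" where
  "dlev T v = (if v = pname T then 0 else lc T v + 1)"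

text \<open>In the last case \<open>v\<close> is not the root, so \<open>lev T v \<ge> 1\<close> and the subtraction does not truncate.\<close>

definition dlsw :: "'a ptree \<Rightarrow> 'a \<Rightarrow> nat" where
  "dlsw T v =
     (if v = pname T then lchain T v
      else if \<exists>u. closest_younger T v u
        then lchain T (THE u. closest_younger T v u) + lev T v
      else lev T v - 1)"

definition drsw :: "'a ptree \<Rightarrow> 'a \<Rightarrow> nat" where
  "drsw T v =
     (if \<exists>u. closest_younger T v u
        then 1 + (\<Sum>w \<in> Lc T v \<union> {THE u. closest_younger T v u, v}. lchain T w)
      else (\<Sum>w \<in> Lc T v \<union> {v}. lchain T w))"

section \<open>The correspondence between plane trees and binary trees\<close>

lemma pname_in_nodes: "pname T \<in> nodes T"
  by (cases T) simp

lemma children_outside: "v \<notin> nodes T \<Longrightarrow> children T v = []"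
  by (induction T) auto

lemma set_children: "set (children T v) \<subseteq> nodes T"
  by (induction T) (auto simp: pname_in_nodes split: if_splits)

lemma set_tree_varphi_forest:
  "set_tree (varphi_forest ts) = set (concat (map names ts))"
  by (induction ts rule: varphi_forest.induct) auto

lemma distinct_inorder_varphi_forest:
  "distinct (concat (map names ts)) \<Longrightarrow> distinct (inorder (varphi_forest ts))"
  by (induction ts rule: varphi_forest.induct) (auto simp: set_tree_varphi_forest)

definition fchildren :: "'a ptree list \<Rightarrow> 'a \<Rightarrow> 'a list" where
  "fchildren ts v = concat (map (\<lambda>t. children t v) ts)"

lemma fchildren_simps [simp]:
  "fchildren [] v = []"
  "fchildren (PNode x ts # us) v = (if v = x then map pname ts else fchildren ts v) @ fchildren us v"
  by (auto simp: fchildren_def comp_def)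

lemma fchildren_outside: "v \<notin> set (concat (map names ts)) \<Longrightarrow> fchildren ts v = []"
  by (auto simp: fchildren_def children_outside)

lemma children_PNode: "children (PNode x ts) v = (if v = x then map pname ts else fchildren ts v)"
  by (simp add: fchildren_def comp_def)

lemma root_varphi_forest:
  "(\<exists>l r. varphi_forest ts = Node l x r) \<longleftrightarrow> (\<exists>xs. map pname ts = x # xs)"
  by (cases ts rule: varphi_forest.cases) auto

lemma left_child_Node:
  "left_child (Node l a r) x y \<longleftrightarrow>
     x = a \<and> (\<exists>l' r'. l = Node l' y r') \<or> left_child l x y \<or> left_child r x y"
  by (auto simp: left_child_def)

lemma right_child_Node:
  "right_child (Node l a r) x y \<longleftrightarrow>
     x = a \<and> (\<exists>l' r'. r = Node l' y r') \<or> right_child l x y \<or> right_child r x y"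
  by (auto simp: right_child_def)

lemma left_child_varphi_forest:
  "distinct (concat (map names ts)) \<Longrightarrow>
   left_child (varphi_forest ts) x y \<longleftrightarrow> (\<exists>ys. fchildren ts x = y # ys)"
proof (induction ts rule: varphi_forest.induct)
  case 1
  show ?case by (simp add: left_child_def)
next
  case (2 a ts us)
  let ?F = "set (concat (map names ts))" and ?G = "set (concat (map names us))"
  have d: "a \<notin> ?F" "a \<notin> ?G" "?F \<inter> ?G = {}"
    "distinct (concat (map names ts))" "distinct (concat (map names us))"
    using "2.prems" by auto
  note IH = "2.IH"(1)[OF d(4)] "2.IH"(2)[OF d(5)]
  have step: "left_child (varphi_forest (PNode a ts # us)) x y \<longleftrightarrow>
    x = a \<and> (\<exists>ys. map pname ts = y # ys) \<or>
    (\<exists>ys. fchildren ts x = y # ys) \<or> (\<exists>ys. fchildren us x = y # ys)"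
    unfolding varphi_forest.simps left_child_Node root_varphi_forest IH ..
  have empty: "x = a \<Longrightarrow> fchildren ts x = []" "x = a \<Longrightarrow> fchildren us x = []"
    "fchildren ts x = [] \<or> fchildren us x = []"
    using d(1-3) fchildren_outside[of x ts] fchildren_outside[of x us] by blast+
  show ?case
  proof (cases "x = a")
    case True
    then show ?thesis
      unfolding step using empty by simp
  next
    case False
    then show ?thesis
      unfolding step using empty(3) by (elim disjE) simp_all
  qed
qed

lemma ex_consecutive_Cons:
  "(\<exists>xs zs. map pname (PNode a ts # us) = xs @ x # y # zs) \<longleftrightarrow>
    (x = a \<and> (\<exists>zs. map pname us = y # zs)) \<or> (\<exists>xs zs. map pname us = xs @ x # y # zs)"
  (is "?L \<longleftrightarrow> ?R")
proof
  assume ?L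
  then obtain xs zs where "a # map pname us = xs @ x # y # zs" by auto
  then show ?R by (cases xs) auto
next
  assume ?R
  then have "\<exists>xs zs. a # map pname us = xs @ x # y # zs"
    by (metis append_Cons append_Nil)
  then show ?L by simp
qed

lemma ex_consecutive_if:
  assumes "f a = []"
  shows "(\<exists>p xs zs. (if p = a then l else f p) = xs @ x # y # zs) \<longleftrightarrow>
    (\<exists>xs zs. l = xs @ x # y # zs) \<or> (\<exists>p xs zs. f p = xs @ x # y # zs)"
proof -
  define Q where "Q l \<longleftrightarrow> (\<exists>xs zs. l = xs @ x # y # zs)" for l
  have "\<not> Q (f a)" by (simp add: Q_def assms)
  then have "(\<exists>p. Q (if p = a then l else f p)) \<longleftrightarrow> Q l \<or> (\<exists>p. Q (f p))" by metis
  then show ?thesis unfolding Q_def .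
qed

lemma ex_consecutive_append:
  assumes "\<And>p. f p = [] \<or> g p = []"
  shows "(\<exists>p xs zs. f p @ g p = xs @ x # y # zs) \<longleftrightarrow>
    (\<exists>p xs zs. f p = xs @ x # y # zs) \<or> (\<exists>p xs zs. g p = xs @ x # y # zs)"
proof -
  define Q where "Q l \<longleftrightarrow> (\<exists>xs zs. l = xs @ x # y # zs)" for l
  have "\<not> Q []" by (simp add: Q_def)
  then have "Q (f p @ g p) \<longleftrightarrow> Q (f p) \<or> Q (g p)" for p
    using assms[of p] by (elim disjE) simp_all
  then have "(\<exists>p. Q (f p @ g p)) \<longleftrightarrow> (\<exists>p. Q (f p)) \<or> (\<exists>p. Q (g p))" by blast
  then show ?thesis unfolding Q_def .
qed

lemma right_child_varphi_forest:
  "distinct (concat (map names ts)) \<Longrightarrow>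
   right_child (varphi_forest ts) x y \<longleftrightarrow>
     (\<exists>xs zs. map pname ts = xs @ x # y # zs) \<or> (\<exists>p xs zs. fchildren ts p = xs @ x # y # zs)"
proof (induction ts rule: varphi_forest.induct)
  case 1
  show ?case by (simp add: right_child_def)
next
  case (2 a ts us)
  let ?F = "set (concat (map names ts))" and ?G = "set (concat (map names us))"
  have d: "a \<notin> ?F" "a \<notin> ?G" "?F \<inter> ?G = {}"
    "distinct (concat (map names ts))" "distinct (concat (map names us))"
    using "2.prems" by auto
  note IH = "2.IH"(1)[OF d(4)] "2.IH"(2)[OF d(5)]
  have 1: "(\<exists>xs zs. map pname (PNode a ts # us) = xs @ x # y # zs) \<longleftrightarrow>
    (x = a \<and> (\<exists>zs. map pname us = y # zs)) \<or> (\<exists>xs zs. map pname us = xs @ x # y # zs)"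
    by (rule ex_consecutive_Cons)
  have fa: "fchildren ts a = []" "fchildren us a = []"
    using d(1,2) fchildren_outside[of a us] fchildren_outside[of a ts] by blast+
  have either: "fchildren ts p = [] \<or> fchildren us p = []" for p
    using d(3) fchildren_outside[of p ts] fchildren_outside[of p us] by blast
  have f: "fchildren (PNode a ts # us) p =
    (if p = a then map pname ts else fchildren ts p @ fchildren us p)" for p
    using fa by simp
  have 2: "(\<exists>p xs zs. fchildren (PNode a ts # us) p = xs @ x # y # zs) \<longleftrightarrow>
    (\<exists>xs zs. map pname ts = xs @ x # y # zs) \<or>
    (\<exists>p xs zs. fchildren ts p @ fchildren us p = xs @ x # y # zs)"
    unfolding f by (rule ex_consecutive_if) (simp add: fa)
  have 3: "(\<exists>p xs zs. fchildren ts p @ fchildren us p = xs @ x # y # zs) \<longleftrightarrow>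
    (\<exists>p xs zs. fchildren ts p = xs @ x # y # zs) \<or> (\<exists>p xs zs. fchildren us p = xs @ x # y # zs)"
    using either by (rule ex_consecutive_append)
  show ?case
    unfolding 1 2 3 varphi_forest.simps right_child_Node root_varphi_forest IH by blast
qed

lemma set_tree_varphi:
  "distinct (names T) \<Longrightarrow> set_tree (varphi T) = nodes T - {pname T}"
  by (cases T) (auto simp: varphi_def set_tree_varphi_forest)

lemma distinct_inorder_varphi:
  "distinct (names T) \<Longrightarrow> distinct (inorder (varphi T))"
  by (cases T) (simp add: varphi_def distinct_inorder_varphi_forest)

lemma root_varphi:
  "(\<exists>l r. varphi T = Node l y r) \<longleftrightarrow> eldest_child T (pname T) y"
  by (cases T) (auto simp: varphi_def root_varphi_forest eldest_child_def)

lemma left_child_varphi: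
  assumes "distinct (names T)" "x \<noteq> pname T"
  shows "left_child (varphi T) x y \<longleftrightarrow> eldest_child T x y"
  using assms
  by (cases T) (simp add: varphi_def left_child_varphi_forest eldest_child_def children_PNode
      del: children.simps)

lemma right_child_varphi:
  assumes "distinct (names T)"
  shows "right_child (varphi T) x y \<longleftrightarrow> closest_younger T x y"
proof (cases T)
  case (PNode a ts)
  have d: "distinct (concat (map names ts))" and a: "fchildren ts a = []"
    using assms PNode fchildren_outside[of a ts] by auto
  show ?thesis
    unfolding PNode varphi_def ptree.sel closest_younger_def children_PNode
      right_child_varphi_forest[OF d] ex_consecutive_if[of "fchildren ts", OF a] ..
qed

primrec unvarphi :: "'a tree \<Rightarrow> 'a ptree list" where
  "unvarphi Leaf = []"
| "unvarphi (Node l x r) = PNode x (unvarphi l) # unvarphi r"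

lemma unvarphi_varphi_forest: "unvarphi (varphi_forest ts) = ts"
  by (induction ts rule: varphi_forest.induct) auto

lemma varphi_forest_unvarphi: "varphi_forest (unvarphi B) = B"
  by (induction B) auto

lemma set_unvarphi: "(\<Union>t \<in> set (unvarphi B). nodes t) = set_tree B"
  by (induction B) auto

lemma distinct_unvarphi:
  "distinct (inorder B) \<Longrightarrow> distinct (concat (map names (unvarphi B)))"
  by (induction B) (simp_all add: set_unvarphi)

theorem bij_betw_varphi: "bij_betw varphi (plane_trees n) (binary_trees n)"
proof (rule bij_betw_byWitness[where f' = "\<lambda>B. PNode 0 (unvarphi B)"])
  show "\<forall>T \<in> plane_trees n. PNode 0 (unvarphi (varphi T)) = T"
  proof
    fix T assume "T \<in> plane_trees n"
    then show "PNode 0 (unvarphi (varphi T)) = T"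
      by (cases T) (simp add: plane_trees_def varphi_def unvarphi_varphi_forest)
  qed
  show "\<forall>B \<in> binary_trees n. varphi (PNode 0 (unvarphi B)) = B"
    by (simp add: varphi_def varphi_forest_unvarphi)
  show "varphi ` plane_trees n \<subseteq> binary_trees n"
  proof
    fix B assume "B \<in> varphi ` plane_trees n"
    then obtain T where T: "T \<in> plane_trees n" and B: "B = varphi T" by blast
    have "distinct (inorder (varphi T))"
      using T distinct_inorder_varphi unfolding plane_trees_def by blast
    moreover have "set_tree (varphi T) = {1..n}"
    proof -
      have "{0..n} - {0} = {1..n}" by auto
      then show ?thesis using T set_tree_varphi[of T] unfolding plane_trees_def by simp
    qed
    moreover have "\<exists>l r. varphi T = Node l 1 r"
      using T root_varphi[of T 1] by (simp add: plane_trees_def)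
    ultimately show "B \<in> binary_trees n" by (simp add: B binary_trees_def)
  qed
  show "(\<lambda>B. PNode 0 (unvarphi B)) ` binary_trees n \<subseteq> plane_trees n"
  proof
    fix T assume "T \<in> (\<lambda>B. PNode 0 (unvarphi B)) ` binary_trees n"
    then obtain B where B: "B \<in> binary_trees n" and T: "T = PNode 0 (unvarphi B)" by blast
    have s: "set (concat (map names (unvarphi B))) = {1..n}"
      using B set_tree_varphi_forest[of "unvarphi B"]
      by (simp add: binary_trees_def varphi_forest_unvarphi)
    have "distinct (names T)"
      using B s by (simp add: T binary_trees_def distinct_unvarphi del: set_concat)
    moreover have "nodes T = {0..n}"
      unfolding T names.simps list.set(2) s by auto
    moreover have "eldest_child T 0 1"
      using B by (auto simp: T binary_trees_def eldest_child_def)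
    ultimately show "T \<in> plane_trees n" by (simp add: T plane_trees_def)
  qed
qed

lemma mirror_binary_trees:
  assumes "B \<in> binary_trees n"
  shows "mirror B \<in> binary_trees n"
proof -
  obtain l r where B: "B = Node l 1 r"
    using assms unfolding binary_trees_def by blast
  have "distinct (inorder (mirror B))"
    using assms unfolding binary_trees_def by (simp add: inorder_mirror)
  moreover have "set_tree (mirror B) = {1..n}"
    using assms set_inorder[of "mirror B"] unfolding binary_trees_def by (simp add: inorder_mirror)
  ultimately show ?thesis
    unfolding binary_trees_def using B by simp
qed

lemma phi_tilde_in_plane_trees:
  assumes "T \<in> plane_trees n"
  shows "phi_tilde n T \<in> plane_trees n"
proof -
  have "varphi T \<in> binary_trees n"
    using bij_betw_apply[OF bij_betw_varphi assms] .
  then show ?thesis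
    unfolding phi_tilde_def
    by (rule bij_betw_apply[OF bij_betw_the_inv_into[OF bij_betw_varphi] mirror_binary_trees])
qed

end

(* Reflecting the binary tree exchanges the relations "eldest child" and "closest younger sibling"
   on the non-root nodes. Hence the left chain of w in the image lists w and its younger siblings
   in T, and, by induction along the path to v in the binary tree, the non-root nodes of the path
   from v to the root of T are v and the elements of Lc(v) in the image. All three equalities are
   consequences of these two facts. *)
theory Submission
  imports Defs
begin

section \<open>Reflection of binary trees\<close>

lemma left_child_mirror: "left_child (mirror B) x y \<longleftrightarrow> right_child B x y"
proof (induction B)
  case Leaf
  then show ?case by (simp add: left_child_def right_child_def)
next
  case (Node l a r)
  have "(\<exists>l' r'. mirror r = Node l' y r') \<longleftrightarrow> (\<exists>l' r'. r = Node l' y r')"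
    by (cases r) auto
  with Node show ?case by (auto simp: left_child_Node right_child_Node)
qed

lemma right_child_mirror: "right_child (mirror B) x y \<longleftrightarrow> left_child B x y"
  using left_child_mirror[of "mirror B"] by simp

text \<open>Mirror images stay in \<open>binary_trees n\<close>, the range of the bijection
  \<open>varphi\<close>, so the inverse in \<open>phi_tilde\<close> really inverts it here.\<close>

lemma varphi_phi_tilde:
  assumes "T \<in> plane_trees n"
  shows "varphi (phi_tilde n T) = mirror (varphi T)"
  unfolding phi_tilde_def
proof (rule f_the_inv_into_f_bij_betw[OF bij_betw_varphi])
  show "mirror (varphi T) \<in> binary_trees n"
    using bij_betw_apply[OF bij_betw_varphi assms] by (rule mirror_binary_trees)
qed

section \<open>Parents and children in trees with distinct names\<close>

text \<open>With distinct names \<open>p\<close> lies in no tree of the list but \<open>t\<close>,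
  so all other lists concatenated in \<open>fchildren\<close> are empty.\<close>

lemma fchildren_eq_children:
  assumes "distinct (concat (map names ts))" "t \<in> set ts" "p \<in> nodes t"
  shows "fchildren ts p = children t p"
  using assms
proof (induction ts)
  case (Cons s ts)
  show ?case
  proof (cases "t = s")
    case True
    then have "p \<notin> set (concat (map names ts))" using Cons.prems by auto
    then have "fchildren ts p = []" by (rule fchildren_outside)
    with True show ?thesis by (simp add: fchildren_def)
  next
    case False
    with Cons.prems have "t \<in> set ts" by simp
    with Cons.prems have "p \<notin> nodes s" by auto
    with Cons \<open>t \<in> set ts\<close> show ?thesis
      by (simp add: fchildren_def children_outside)
  qed
qed simp

lemma disjoint_nodes:
  assumes "distinct (concat (map names ts))" "t \<in> set ts" "t' \<in> set ts" "v \<in> nodes t" "v \<in> nodes t'"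
  shows "t = t'"
  using assms
proof (induction ts)
  case (Cons s ts)
  then have "v \<in> nodes s \<Longrightarrow> u \<in> set ts \<Longrightarrow> v \<notin> nodes u" for u by auto
  with Cons show ?case by auto
qed simp

lemma mem_children_nodes: "c \<in> set (children T p) \<Longrightarrow> c \<in> nodes T \<and> p \<in> nodes T"
  using set_children children_outside by (metis empty_iff list.set(1) subsetD)

locale distinct_ptree =
  fixes T :: "'a ptree"
  assumes distinct_names: "distinct (names T)"
begin

lemma children_subtree:
  assumes "T = PNode r ts" "t \<in> set ts" "p \<in> nodes t"
  shows "children T p = children t p"
proof -
  have "p \<noteq> r" using assms distinct_names by auto
  then show ?thesis
    using assms distinct_names fchildren_eq_children[of ts t p] by (simp add: children_PNode del: children.simps)
qed

end

lemma distinct_ptree_subtree: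
  "distinct_ptree (PNode r ts) \<Longrightarrow> t \<in> set ts \<Longrightarrow> distinct_ptree t"
  by (auto simp: distinct_ptree_def distinct_concat_iff)

lemma root_not_child:
  "distinct_ptree T \<Longrightarrow> pname T \<notin> set (children T p)"
proof (induction T)
  case (PNode r ts)
  have r: "r \<notin> set (concat (map names ts))"
    using PNode.prems by (simp add: distinct_ptree_def)
  then have "r \<noteq> pname t" "r \<notin> set (children t p)" if "t \<in> set ts" for t
    using that pname_in_nodes[of t] mem_children_nodes[of r t p] by auto
  then show ?case by (auto simp: children_PNode fchildren_def simp del: children.simps)
qed

lemma distinct_map_pname:
  "distinct (concat (map names ts)) \<Longrightarrow> distinct (map pname ts)"
proof (induction ts)
  case (Cons t ts)
  have "pname t \<noteq> pname u" if "u \<in> set ts" for u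
    using Cons.prems that pname_in_nodes[of t] pname_in_nodes[of u] by auto
  with Cons show ?case by auto
qed simp

lemma distinct_children:
  "distinct_ptree T \<Longrightarrow> distinct (children T p)"
proof (induction T)
  case (PNode r ts)
  show ?case
  proof (cases "p \<in> nodes (PNode r ts) \<and> p \<noteq> r")
    case True
    then obtain t where t: "t \<in> set ts" "p \<in> nodes t" by auto
    then show ?thesis
      using PNode.IH[OF t(1)] distinct_ptree_subtree[OF PNode.prems t(1)]
        distinct_ptree.children_subtree[OF PNode.prems refl t] by simp
  next
    case False
    then show ?thesis
      using distinct_map_pname[of ts] PNode.prems children_outside[of p "PNode r ts"]
      by (auto simp: distinct_ptree_def simp del: children.simps) (simp add: children_PNode)
  qed
qed

text \<open>Either \<open>v\<close> heads an immediate subtree and its parent is the root, or its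
  parent lies inside an immediate subtree. These cases exclude each other because the root of a
  subtree is no child in it; in the second case disjointness puts both parents into one subtree,
  where the induction hypothesis applies.\<close>

lemma parent_unique:
  "distinct_ptree T \<Longrightarrow> v \<in> set (children T p) \<Longrightarrow> v \<in> set (children T q) \<Longrightarrow> p = q"
proof (induction T)
  case (PNode r ts)
  note d = PNode.prems(1)
  have cases: "a = r \<and> v \<in> pname ` set ts \<or>
      (\<exists>t \<in> set ts. v \<in> set (children t a))" if "v \<in> set (children (PNode r ts) a)" for a
    using that by (auto simp: children_PNode fchildren_def split: if_splits simp del: children.simps)
  have disj: "t = t'" if "t \<in> set ts" "t' \<in> set ts" "v \<in> nodes t" "v \<in> nodes t'" for t t'
    using disjoint_nodes[of ts t t' v] d that by (simp add: distinct_ptree_def)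
  have root: False if h: "t \<in> set ts" "v \<in> pname ` set ts" "v \<in> set (children t a)" for t a
  proof -
    obtain s where s: "s \<in> set ts" "v = pname s" using h by blast
    have "t = s"
      by (rule disj[OF h(1) s(1)]) (use mem_children_nodes[OF h(3)] pname_in_nodes[of s] s(2) in simp_all)
    then show False
      using root_not_child[OF distinct_ptree_subtree[OF d h(1)], of a] s(2) h(3) by simp
  qed
  show ?case
    using cases[OF PNode.prems(2)] cases[OF PNode.prems(3)] root disj mem_children_nodes
      PNode.IH[OF _ distinct_ptree_subtree[OF d]] by metis
qed

text \<open>Induction from the root downwards inside a fixed tree. It suits the statistics, which
  refer to the whole tree and not to subtrees.\<close>

lemma nodes_induct:
  assumes "distinct_ptree T" "v \<in> nodes T"
    and "P (pname T)"
    and "\<And>p c. P p \<Longrightarrow> c \<in> set (children T p) \<Longrightarrow> P c"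
  shows "P v"
  using assms
proof (induction T)
  case (PNode r ts)
  show ?case
  proof (cases "v = r")
    case True
    with PNode.prems show ?thesis by simp
  next
    case False
    with PNode.prems obtain t where t: "t \<in> set ts" "v \<in> nodes t" by auto
    note d = PNode.prems(1)
    show ?thesis
    proof (rule PNode.IH[OF t(1) distinct_ptree_subtree[OF d t(1)] t(2)])
      show "P (pname t)"
        using PNode.prems(3,4) t(1) by (fastforce simp: children_PNode)
      show "P c" if "P p" "c \<in> set (children t p)" for p c
        using PNode.prems(4)[OF that(1)] that(2) mem_children_nodes[OF that(2)]
          distinct_ptree.children_subtree[OF d refl t(1)] by simp
    qed
  qed
qed

text \<open>A node determines its eldest child, so two such chains agree step by step, and both stop
  at the first childless node. This discharges the \<open>THE\<close> in
  \<open>left_chain\<close>.\<close>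

lemma left_chain_unique:
  assumes "c \<noteq> []" "hd c = v" "children T (last c) = []" "successively (eldest_child T) c"
  shows "left_chain T v = c"
proof -
  have "c' = c" if "c' \<noteq> []" "hd c' = hd c" "children T (last c') = []"
    "successively (eldest_child T) c'" for c'
    using assms(1,3,4) that
  proof (induction c arbitrary: c')
    case (Cons x c)
    obtain d where d: "c' = x # d" using Cons.prems by (cases c') auto
    show ?case
    proof (cases "c = [] \<or> d = []")
      case True
      then show ?thesis
        using Cons.prems d by (cases c; cases d) (auto simp: eldest_child_def)
    next
      case False
      then have "eldest_child T x (hd c)" "eldest_child T x (hd d)"
        using Cons.prems d by (cases c; cases d; simp)+
      then have "hd d = hd c" by (auto simp: eldest_child_def)
      then have "d = c"
        using Cons.IH[of d] Cons.prems False d by (cases c; cases d; simp)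
      with d show ?thesis by simp
    qed
  qed simp
  then show ?thesis
    unfolding left_chain_def using assms by (intro the_equality) blast+
qed

context distinct_ptree
begin

lemmas root_not_child = root_not_child[OF distinct_ptree_axioms]
  and distinct_children = distinct_children[OF distinct_ptree_axioms]
  and parent_unique = parent_unique[OF distinct_ptree_axioms]
  and nodes_induct = nodes_induct[OF distinct_ptree_axioms, consumes 1, case_names root child]

section \<open>Siblings\<close>

lemma children_eq:
  "v \<in> set (children T p) \<Longrightarrow> children T q = xs @ v # ys \<Longrightarrow> q = p"
  using parent_unique[of v p q] by simp

text \<open>The parent of \<open>v\<close> is unique, and \<open>v\<close> occurs only once in its
  list of children. Hence all sibling relations of \<open>v\<close> can be read off from one
  splitting.\<close>

lemma children_split_unique:
  assumes "children T p = xs @ v # ys" "children T q = xs' @ v # ys'"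
  shows "q = p \<and> xs' = xs \<and> ys' = ys"
proof -
  have "q = p" using children_eq[of v p q xs' ys'] assms by simp
  moreover have "distinct (xs @ v # ys)" using distinct_children[of p] assms(1) by simp
  moreover have "xs' @ v # ys' = xs @ v # ys" using \<open>q = p\<close> assms by simp
  ultimately show ?thesis
    by (auto simp: append_eq_append_conv2 append_eq_Cons_conv Cons_eq_append_conv)
qed

lemma siblings_eq:
  assumes "children T p = xs @ v # ys"
  shows "elder_siblings T v = set xs" "younger_siblings T v = set ys"
proof -
  have "u \<in> set xs" if "children T q = as @ u # bs @ v # cs" for u q as bs cs
    using children_split_unique[OF assms, of q "as @ u # bs" cs] that by auto
  moreover have "\<exists>q as bs cs. children T q = as @ u # bs @ v # cs" if "u \<in> set xs" for u
    using assms split_list[OF that] by fastforce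
  ultimately show "elder_siblings T v = set xs"
    unfolding elder_siblings_def by blast
  have "u \<in> set ys" if "children T q = as @ v # bs @ u # cs" for u q as bs cs
    using children_split_unique[OF assms, of q as "bs @ u # cs"] that by auto
  moreover have "\<exists>q as bs cs. children T q = as @ v # bs @ u # cs" if "u \<in> set ys" for u
    using assms split_list[OF that] by fastforce
  ultimately show "younger_siblings T v = set ys"
    unfolding younger_siblings_def by blast
qed

lemma closest_younger_iff:
  assumes "children T p = xs @ v # ys"
  shows "closest_younger T v u \<longleftrightarrow> (\<exists>zs. ys = u # zs)"
proof
  assume "closest_younger T v u"
  then obtain q as cs where "children T q = as @ v # u # cs"
    unfolding closest_younger_def by blast
  with children_split_unique[OF assms this] show "\<exists>zs. ys = u # zs" by blast
qed (use assms in \<open>auto simp: closest_younger_def\<close>)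

lemma child_splitE:
  assumes "v \<in> nodes T" "v \<noteq> pname T"
  obtains p xs ys where "children T p = xs @ v # ys"
proof -
  have "v \<noteq> pname T \<longrightarrow> (\<exists>p. v \<in> set (children T p))"
    using assms(1) by (induction rule: nodes_induct) auto
  then show thesis using assms(2) that by (metis split_list)
qed

section \<open>Paths to the root and levels\<close>

text \<open>The property described by \<open>THE\<close> in \<open>root_path\<close>, named so that
  its unique solvability can be proved by induction from the root.\<close>

definition is_root_path :: "'a \<Rightarrow> 'a list \<Rightarrow> bool" where
  "is_root_path v p \<longleftrightarrow> p \<noteq> [] \<and> hd p = v \<and> last p = pname T \<and>
     successively (\<lambda>x y. x \<in> set (children T y)) p"

lemma is_root_path_root: "is_root_path (pname T) p \<longleftrightarrow> p = [pname T]"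
  unfolding is_root_path_def using root_not_child
  by (cases p) (auto simp: successively_Cons)

lemma is_root_path_child:
  assumes "v \<in> set (children T q)"
  shows "is_root_path v p \<longleftrightarrow> (\<exists>p'. p = v # p' \<and> is_root_path q p')"
proof (cases p)
  case (Cons x p')
  have "v \<noteq> pname T" using assms root_not_child by blast
  then show ?thesis
    unfolding is_root_path_def Cons using assms parent_unique
    by (auto simp: successively_Cons)
qed (simp add: is_root_path_def)

lemma root_path_ex1: "v \<in> nodes T \<Longrightarrow> \<exists>!p. is_root_path v p"
proof (induction rule: nodes_induct)
  case root
  then show ?case by (simp add: is_root_path_root)
next
  case (child p c)
  then show ?case by (auto simp: is_root_path_child)
qed

lemma root_path_eq: "root_path T v = (THE p. is_root_path v p)"
  by (simp add: root_path_def is_root_path_def)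

lemma root_path_root: "root_path T (pname T) = [pname T]"
  by (simp add: root_path_eq is_root_path_root)

text \<open>With \<open>root_path_root\<close> this recursion replaces the description by
  \<open>THE\<close>; the recursions for \<open>lev\<close> and \<open>Lc\<close> follow from
  it.\<close>

lemma root_path_child:
  assumes "v \<in> set (children T q)"
  shows "root_path T v = v # root_path T q"
proof -
  have q: "\<exists>!p. is_root_path q p" and v: "\<exists>!p. is_root_path v p"
    using root_path_ex1 mem_children_nodes[OF assms] by simp_all
  have "is_root_path q (root_path T q)"
    unfolding root_path_eq using q by (rule theI')
  then have "is_root_path v (v # root_path T q)"
    using is_root_path_child[OF assms] by simp
  with v show ?thesis
    unfolding root_path_eq[of v] by (rule the1_equality)
qed

lemma lev_root: "lev T (pname T) = 0"
  by (simp add: lev_def root_path_root)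

lemma root_path_nonempty: "v \<in> nodes T \<Longrightarrow> root_path T v \<noteq> []"
  by (induction rule: nodes_induct) (simp_all add: root_path_root root_path_child)

lemma lev_child:
  assumes "v \<in> set (children T q)"
  shows "lev T v = Suc (lev T q)"
  using root_path_nonempty[of q] mem_children_nodes[OF assms]
  by (simp add: lev_def root_path_child[OF assms])

lemma lev_less_on_root_path:
  assumes "v \<in> nodes T" "w \<in> set (root_path T v)"
  shows "w = v \<or> lev T w < lev T v"
  using assms
  by (induction arbitrary: w rule: nodes_induct)
    (auto simp: root_path_root root_path_child lev_child less_Suc_eq)

text \<open>The nodes on a path are distinct, since levels decrease along it. The cardinality makes
  the set equality \<open>root_path_eq_Lc\<close> applicable to levels.\<close>

lemma lev_eq_card:
  assumes "v \<in> nodes T"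
  shows "lev T v = card (set (root_path T v) - {pname T})"
  using assms
proof (induction rule: nodes_induct)
  case root
  then show ?case by (simp add: lev_root root_path_root)
next
  case (child p c)
  have c: "c \<noteq> pname T" using child root_not_child by blast
  have "c \<notin> set (root_path T p)"
    using lev_less_on_root_path[of p c] mem_children_nodes[OF child(2)] lev_child[OF child(2)]
    by force
  then show ?case
    using child c by (simp add: root_path_child lev_child insert_Diff_if)
qed

lemma root_path_subset: "v \<in> nodes T \<Longrightarrow> set (root_path T v) \<subseteq> nodes T"
  by (induction rule: nodes_induct)
    (auto simp: root_path_root root_path_child pname_in_nodes dest: mem_children_nodes)

section \<open>The sets \<open>Lc\<close>\<close>

lemma Lc_root: "Lc T (pname T) = {}"
  by (simp add: Lc_def root_path_root)

lemma Lc_child: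
  assumes "v \<in> set (children T q)"
  shows "Lc T v = elder_siblings T v \<union> Lc T q"
  using assms root_not_child[of q]
  by (auto simp: Lc_def root_path_child[OF assms] insert_Diff_if)

lemma Lc_eldest_root: "eldest_child T (pname T) v \<Longrightarrow> Lc T v = {}"
  using Lc_child[of v "pname T"] siblings_eq(1)[of "pname T" "[]" v] Lc_root
  by (auto simp: eldest_child_def)

text \<open>With \<open>Lc_closest_younger\<close> this is a recursion for \<open>Lc\<close> along
  the binary tree: a left edge leaves the set unchanged, a right edge adds its upper end.\<close>

lemma Lc_eldest:
  assumes "eldest_child T p v"
  shows "Lc T v = Lc T p"
  using assms Lc_child[of v p] siblings_eq(1)[of p "[]" v] by (auto simp: eldest_child_def)

lemma Lc_closest_younger:
  assumes "closest_younger T p v"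
  shows "Lc T v = insert p (Lc T p)"
proof -
  obtain q xs ys where q: "children T q = xs @ p # v # ys"
    using assms unfolding closest_younger_def by blast
  then show ?thesis
    using siblings_eq(1)[of q xs p] siblings_eq(1)[of q "xs @ [p]" v]
      Lc_child[of v q] Lc_child[of p q] by auto
qed

lemma finite_Lc: "v \<in> nodes T \<Longrightarrow> finite (Lc T v)"
proof (induction rule: nodes_induct)
  case root
  then show ?case by (simp add: Lc_root)
next
  case (child p c)
  obtain xs ys where "children T p = xs @ c # ys" using child(2) by (meson split_list)
  from siblings_eq(1)[OF this] show ?case using child Lc_child[OF child(2)] by simp
qed

lemma lev_elder_sibling:
  assumes "u \<in> elder_siblings T w"
  shows "lev T u = lev T w"
proof -
  obtain p xs ys zs where "children T p = xs @ u # ys @ w # zs"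
    using assms unfolding elder_siblings_def by blast
  then have "u \<in> set (children T p)" "w \<in> set (children T p)" by simp_all
  then show ?thesis by (simp add: lev_child)
qed

lemma elder_siblings_irrefl: "v \<notin> elder_siblings T v"
proof
  assume "v \<in> elder_siblings T v"
  then obtain p xs ys zs where "children T p = xs @ v # ys @ v # zs"
    unfolding elder_siblings_def by blast
  then show False using distinct_children[of p] by simp
qed

text \<open>Elder siblings have equal levels, while the other nodes on the path from
  \<open>v\<close> have smaller levels than \<open>v\<close>. So \<open>v\<close> would be its own
  elder sibling.\<close>

lemma not_mem_Lc_self:
  assumes "v \<in> nodes T"
  shows "v \<notin> Lc T v"
proof
  assume "v \<in> Lc T v"
  then obtain w where w: "w \<in> set (root_path T v)" "v \<in> elder_siblings T w"
    unfolding Lc_def by blast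
  then have "w = v"
    using lev_less_on_root_path[OF assms] lev_elder_sibling[of v w] by force
  with w show False using elder_siblings_irrefl by simp
qed

text \<open>Induction along the paths of the associated binary tree.\<close>

lemma binary_induct [consumes 2, case_names root eldest younger]:
  assumes "v \<in> nodes T" "v \<noteq> pname T"
    and root: "\<And>c. eldest_child T (pname T) c \<Longrightarrow> P c"
    and eldest: "\<And>p c. P p \<Longrightarrow> p \<in> nodes T \<Longrightarrow> p \<noteq> pname T \<Longrightarrow> eldest_child T p c \<Longrightarrow> P c"
    and younger: "\<And>p c. P p \<Longrightarrow> p \<in> nodes T \<Longrightarrow> p \<noteq> pname T \<Longrightarrow> closest_younger T p c \<Longrightarrow> P c"
  shows "P v"
proof -
  have "v \<noteq> pname T \<longrightarrow> P v"
    using assms(1)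
  proof (induction rule: nodes_induct)
    case root
    then show ?case by simp
  next
    case (child p c)
    have p: "p \<in> nodes T" using mem_children_nodes[OF child(2)] by simp
    \<comment> \<open>An inner induction walks along the siblings, starting from the eldest one. For
      that one the case \<open>root\<close> or \<open>eldest\<close> applies, according to whether
      \<open>p\<close> is the root.\<close>
    have "children T p = xs @ c # ys \<Longrightarrow> P c" for xs c ys
    proof (induction xs arbitrary: c ys rule: rev_induct)
      case Nil
      then have "eldest_child T p c" by (simp add: eldest_child_def)
      then show ?case using child(1) root eldest p by blast
    next
      case (snoc x xs)
      then have x: "x \<in> set (children T p)" and "closest_younger T x c"
        by (auto simp: closest_younger_def)
      moreover have "P x" using snoc by simp
      ultimately show ?case
        using younger mem_children_nodes[OF x] root_not_child by metis
    qed
    then show ?case using child(2) by (meson split_list)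
  qed
  with assms(2) show ?thesis by simp
qed

end

section \<open>A tree and its image under the reflection\<close>

text \<open>The root is treated apart because it is no node of the binary tree. Its eldest child is
  the root of the binary tree, which the reflection fixes.\<close>

locale mirror_ptrees = T: distinct_ptree T + S: distinct_ptree S for T S :: "'a ptree" +
  assumes pname_eq: "pname S = pname T"
    and nodes_eq: "nodes S = nodes T"
    and eldest_root: "eldest_child S (pname T) y \<longleftrightarrow> eldest_child T (pname T) y"
    and eldest_iff: "x \<noteq> pname T \<Longrightarrow> eldest_child S x y \<longleftrightarrow> closest_younger T x y"
    and younger_iff: "x \<noteq> pname T \<Longrightarrow> closest_younger S x y \<longleftrightarrow> eldest_child T x y"
begin

text \<open>A step to an eldest child in \<open>T\<close> extends the path by \<open>c\<close>; in
  \<open>S\<close> it is a step to a younger sibling, which adds \<open>p\<close> to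
  \<open>Lc\<close>. A step to a younger sibling in \<open>T\<close> replaces \<open>p\<close> by
  \<open>c\<close> on the path; in \<open>S\<close> it is a step to an eldest child, which keeps
  \<open>Lc\<close>.\<close>

lemma root_path_eq_Lc:
  assumes "v \<in> nodes T" "v \<noteq> pname T"
  shows "set (root_path T v) - {pname T} = insert v (Lc S v)"
  using assms
proof (induction rule: T.binary_induct)
  case (root c)
  then have "c \<in> set (children T (pname T))" by (auto simp: eldest_child_def)
  moreover from this have "c \<noteq> pname T" using T.root_not_child by metis
  moreover have "Lc S c = {}"
    using root S.Lc_eldest_root by (simp add: pname_eq eldest_root)
  ultimately show ?case by (auto simp: T.root_path_child T.root_path_root)
next
  case (eldest p c)
  have c: "c \<in> set (children T p)" using eldest(4) by (auto simp: eldest_child_def)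
  then have "c \<noteq> pname T" using T.root_not_child by metis
  moreover have "Lc S c = insert p (Lc S p)"
    using eldest(3,4) by (intro S.Lc_closest_younger) (simp add: younger_iff)
  ultimately show ?case
    using eldest(1) by (simp add: T.root_path_child[OF c] insert_Diff_if)
next
  case (younger p c)
  obtain q xs ys where q: "children T q = xs @ p # c # ys"
    using younger(4) by (auto simp: closest_younger_def)
  then have pc: "p \<in> set (children T q)" "c \<in> set (children T q)" by auto
  then have "c \<noteq> pname T" using T.root_not_child by metis
  \<comment> \<open>The induction hypothesis has \<open>p\<close> inserted on both sides. It can be
    cancelled because neither remaining set contains it.\<close>
  have "p \<notin> set (root_path T q)"
    using T.lev_less_on_root_path[of q p] mem_children_nodes[OF pc(1)] T.lev_child[OF pc(1)]
    by force
  moreover have "p \<notin> Lc S p" using S.not_mem_Lc_self younger(2) nodes_eq by simp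
  moreover have "insert p (set (root_path T q) - {pname T}) = insert p (Lc S p)"
    using younger(1,3) by (simp add: T.root_path_child[OF pc(1)] insert_Diff_if)
  ultimately have "set (root_path T q) - {pname T} = Lc S p" by (metis DiffD1 insert_ident)
  moreover have "Lc S c = Lc S p"
    using younger(3,4) by (intro S.Lc_eldest) (simp add: eldest_iff)
  ultimately show ?case
    using \<open>c \<noteq> pname T\<close> by (simp add: T.root_path_child[OF pc(2)] insert_Diff_if)
qed

text \<open>The summand 1 counts \<open>v\<close> itself, which is not in
  \<open>Lc S v\<close>.\<close>

lemma lev_eq_lc:
  assumes "v \<in> nodes T" "v \<noteq> pname T"
  shows "lev T v = lc S v + 1"
  using assms S.finite_Lc[of v] S.not_mem_Lc_self[of v]
  by (simp add: T.lev_eq_card root_path_eq_Lc nodes_eq lc_def)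

text \<open>The next sibling in \<open>T\<close> is the eldest child in \<open>S\<close>, and the
  last sibling in \<open>T\<close> is a leaf of \<open>S\<close>. So \<open>w # ys\<close> is the
  left chain of \<open>w\<close> in \<open>S\<close>.\<close>

lemma chain_mirror:
  assumes "children T p = xs @ w # ys"
  shows "children S (last (w # ys)) = [] \<and> successively (eldest_child S) (w # ys)"
  using assms
proof (induction ys arbitrary: xs w)
  case Nil
  then have "w \<noteq> pname T" using T.root_not_child[of p] by auto
  then have "\<not> eldest_child S w y" for y
    using T.closest_younger_iff[OF Nil] by (simp add: eldest_iff)
  then show ?case by (cases "children S w") (auto simp: eldest_child_def)
next
  case (Cons y ys)
  then have "w \<noteq> pname T" using T.root_not_child[of p] by auto
  moreover have "closest_younger T w y" using T.closest_younger_iff[OF Cons.prems] by simp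
  moreover have "children T p = (xs @ [w]) @ y # ys" using Cons.prems by simp
  from Cons.IH[OF this]
  have "children S (last (y # ys)) = [] \<and> successively (eldest_child S) (y # ys)" .
  ultimately show ?case by (simp add: eldest_iff)
qed

lemma lchain_mirror:
  assumes "children T p = xs @ w # ys"
  shows "lchain S w = length ys"
  using left_chain_unique[of "w # ys" w S] chain_mirror[OF assms] by (simp add: lchain_def)

text \<open>Turns the summands of \<open>rsw\<close> in \<open>T\<close> into those of
  \<open>drsw\<close> in \<open>S\<close>.\<close>

lemma lchain_younger_siblings:
  assumes "w \<in> nodes T" "w \<noteq> pname T"
  shows "lchain S w = card (younger_siblings T w)"
proof -
  obtain p xs ys where p: "children T p = xs @ w # ys"
    using T.child_splitE[OF assms] .
  have "distinct ys" using T.distinct_children[of p] p by simp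
  then show ?thesis by (simp add: lchain_mirror[OF p] T.siblings_eq[OF p] distinct_card)
qed

text \<open>Both trees have the same eldest child of the root, and from there the chain in
  \<open>S\<close> runs through the remaining children in \<open>T\<close>. The edge leaving the
  root accounts for the first child.\<close>

lemma lchain_root: "lchain S (pname T) = length (children T (pname T))"
proof (cases "children T (pname T)")
  case Nil
  then have "\<not> eldest_child S (pname T) y" for y
    using eldest_root by (simp add: eldest_child_def)
  then have "children S (pname T) = []"
    by (cases "children S (pname T)") (auto simp: eldest_child_def)
  then have "left_chain S (pname T) = [pname T]"
    by (intro left_chain_unique) auto
  with Nil show ?thesis by (simp add: lchain_def)
next
  case (Cons c cs)
  then have "eldest_child S (pname T) c" using eldest_root by (simp add: eldest_child_def)
  then have "left_chain S (pname T) = pname T # c # cs"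
    using chain_mirror[of "pname T" "[]" c cs] Cons by (intro left_chain_unique) auto
  with Cons show ?thesis by (simp add: lchain_def)
qed

text \<open>With \<open>no_closest_younger_mirror\<close> this decides the case distinctions in
  \<open>dlsw\<close> and \<open>drsw\<close> and evaluates their \<open>THE\<close>.\<close>

lemma closest_younger_mirror:
  assumes "v \<noteq> pname T" "children T v = u # us"
  shows "closest_younger S v x \<longleftrightarrow> x = u"
  using assms by (auto simp: younger_iff eldest_child_def)

lemma no_closest_younger_mirror:
  assumes "v = pname T \<or> children T v = []"
  shows "\<not> closest_younger S v x"
proof (cases "v = pname T")
  case True
  then have "v \<notin> set (children S p)" for p using S.root_not_child pname_eq by metis
  then show ?thesis unfolding closest_younger_def by (metis in_set_conv_decomp)
next
  case False
  with assms show ?thesis by (simp add: younger_iff eldest_child_def)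
qed

lemma rsw_eq:
  assumes "v \<in> nodes T" "v \<noteq> pname T"
  shows "rsw T v = length (children T v) + (\<Sum>w \<in> insert v (Lc S v). lchain S w)"
proof -
  have "w \<in> nodes T \<and> w \<noteq> pname T" if "w \<in> insert v (Lc S v)" for w
    using that T.root_path_subset[OF assms(1)] unfolding root_path_eq_Lc[OF assms, symmetric]
    by auto
  then have "(\<Sum>w \<in> insert v (Lc S v). card (younger_siblings T w)) =
      (\<Sum>w \<in> insert v (Lc S v). lchain S w)"
    by (intro sum.cong refl) (simp add: lchain_younger_siblings)
  then show ?thesis by (simp only: rsw_def root_path_eq_Lc[OF assms])
qed

lemma rsw_eq_drsw:
  assumes "v \<in> nodes T"
  shows "rsw T v = drsw S v"
proof (cases "v = pname T")
  case True
  then show ?thesis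
    using no_closest_younger_mirror[of v] S.Lc_root lchain_root
    by (simp add: drsw_def rsw_def T.root_path_root pname_eq)
next
  case False
  show ?thesis
  proof (cases "children T v")
    case Nil
    then show ?thesis
      using no_closest_younger_mirror[of v] by (simp add: drsw_def rsw_eq[OF assms False])
  next
    case (Cons u us)
    have younger: "closest_younger S v x \<longleftrightarrow> x = u" for x
      using closest_younger_mirror[OF False Cons] .
    have u: "u \<in> nodes S" using mem_children_nodes[of u T v] Cons nodes_eq by simp
    \<comment> \<open>This set is \<open>Lc S u\<close>. The summand for \<open>u\<close> can
      therefore be split off; together with the 1 in \<open>drsw\<close> it gives the number of
      children of \<open>v\<close> in \<open>T\<close>.\<close>
    have "u \<notin> insert v (Lc S v)"
      using S.not_mem_Lc_self[OF u] S.Lc_closest_younger[of v u] younger by simp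
    moreover have "finite (insert v (Lc S v))" using S.finite_Lc assms nodes_eq by simp
    moreover have "lchain S u = length us" using lchain_mirror[of v "[]" u us] Cons by simp
    ultimately have "1 + (\<Sum>w \<in> insert u (insert v (Lc S v)). lchain S w) = rsw T v"
      using Cons by (simp only: rsw_eq[OF assms False] sum.insert) simp
    moreover have "Lc S v \<union> {u, v} = insert u (insert v (Lc S v))" by blast
    ultimately show ?thesis by (simp only: drsw_def younger simp_thms the_eq_trivial if_True)
  qed
qed

text \<open>The equality for \<open>lsw\<close> involves \<open>lc T v\<close> and so needs
  \<open>lev_eq_lc\<close> with the two trees exchanged.\<close>

lemma flip: "mirror_ptrees S T"
  by unfold_locales
    (simp_all add: pname_eq nodes_eq eldest_root eldest_iff younger_iff)

lemma lev_eq_dlev: "v \<in> nodes T \<Longrightarrow> lev T v = dlev S v"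
  using lev_eq_lc T.lev_root by (simp add: dlev_def pname_eq)

lemma lsw_eq_dlsw:
  assumes "v \<in> nodes T"
  shows "lsw T v = dlsw S v"
proof (cases "v = pname T")
  case True
  then show ?thesis
    using T.Lc_root lchain_root by (simp add: dlsw_def lsw_def lc_def pname_eq)
next
  case False
  interpret flip: mirror_ptrees S T by (rule flip)
  \<comment> \<open>At a leaf of \<open>T\<close> the 1 cancels against the subtraction in
    \<open>dlsw\<close>; otherwise it counts the eldest child \<open>u\<close>, and
    \<open>lchain S u\<close> counts the other children.\<close>
  have lev: "lev S v = lc T v + 1"
    using flip.lev_eq_lc[of v] assms False by (simp add: pname_eq nodes_eq)
  show ?thesis
  proof (cases "children T v")
    case Nil
    then show ?thesis
      using no_closest_younger_mirror[of v] False lev by (simp add: dlsw_def lsw_def pname_eq)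
  next
    case (Cons u us)
    have "closest_younger S v = (\<lambda>x. x = u)"
      using closest_younger_mirror[OF False Cons] by blast
    with Cons show ?thesis
      using lchain_mirror[of v "[]" u us] False lev by (simp add: dlsw_def lsw_def pname_eq)
  qed
qed

end

section \<open>Application to the involution\<close>

lemma mirror_ptrees_phi_tilde:
  assumes "T \<in> plane_trees n"
  shows "mirror_ptrees T (phi_tilde n T)"
proof -
  define S where "S = phi_tilde n T"
  have S: "S \<in> plane_trees n"
    using phi_tilde_in_plane_trees[OF assms] by (simp add: S_def)
  have d: "distinct (names T)" "distinct (names S)" and r: "pname T = 0" "pname S = 0"
    using assms S by (simp_all add: plane_trees_def)
  have v: "varphi S = mirror (varphi T)"
    using varphi_phi_tilde[OF assms] by (simp add: S_def)
  have "mirror_ptrees T S"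
  proof
    \<comment> \<open>Membership in \<open>plane_trees n\<close> makes \<open>1\<close> the eldest
      child of the root \<open>0\<close> in both trees.\<close>
    show "eldest_child S (pname T) y \<longleftrightarrow> eldest_child T (pname T) y" for y
      using assms S r by (auto simp: plane_trees_def eldest_child_def)
    show "eldest_child S x y \<longleftrightarrow> closest_younger T x y" if "x \<noteq> pname T" for x y
      using left_child_varphi[OF d(2), of x y] right_child_varphi[OF d(1), of x y] that r
      by (simp add: v left_child_mirror)
    show "closest_younger S x y \<longleftrightarrow> eldest_child T x y" if "x \<noteq> pname T" for x y
      using right_child_varphi[OF d(2), of x y] left_child_varphi[OF d(1), of x y] that r
      by (simp add: v right_child_mirror)
  qed (use assms S in \<open>auto simp: plane_trees_def\<close>)
  then show ?thesis by (simp add: S_def)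
qed

theorem theorem2p11:
  fixes n :: nat and T :: "nat ptree" and v :: nat
  assumes "n \<ge> 1" and "T \<in> plane_trees n" and "v \<in> nodes T"
  shows "(lev T v, lsw T v, rsw T v) =
    (dlev (phi_tilde n T) v, dlsw (phi_tilde n T) v, drsw (phi_tilde n T) v)"
proof -
  interpret mirror_ptrees T "phi_tilde n T"
    using assms(2) by (rule mirror_ptrees_phi_tilde)
  show ?thesis
    using assms(3) by (simp add: lev_eq_dlev lsw_eq_dlsw rsw_eq_drsw)
qed

end
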